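(* For a rational prime $p$ and a number field $K$ let $$s(p,K)=\begin{cases}1, & S_K(p)=\{1\}\\ 0, & \text{otherwise.}\end{cases}$$ The exceptional set of $s$ is non-empty for some number fields: there exist number fields $K_1$ and $K_2$ such that $s(p,K_1)=s(p,K_2)$ for all but finitely many rational primes $p$, but $s(p,K_1)\neq s(p,K_2)$ for at least one rational prime $p$.
   Context: For a number field $F$ and a rational prime $p$ with $p\mathcal{O}_F=\mathfrak{p}_1^{e_1}\cdots\mathfrak{p}_n^{e_n}$ (distinct primes $\mathfrak p_i$), the splitting type $S_F(p)$ is the multiset $\{f_i\}_{i=1}^n$ of residual degrees $f_i=[\mathcal{O}_F/\mathfrak{p}_i:\mathbb{Z}/p\mathbb{Z}]$ (ramification indices are not recorded). Here $\{1\}$ is the multiset containing $1$ with multiplicity exactly one, so $S_K(p)=\{1\}$ means there is exactly one prime of $K$ over $p$ and its residual degree is $1$. Two number fields are equivalent for the notion of arithmetic similarity induced by $s$ if $s(p,\cdot)$ agrees on them for all but finitely many $p$; the exceptional set of $s$ for two equivalent number fields is the set of rational primes $p$ where the values of $s$ differ. *)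

theory Defs
  imports
    "HOL-Algebra.Algebra"
    "HOL-Algebra.Algebraic_Closure_Type"
    "HOL-Computational_Algebra.Computational_Algebra"
    "HOL-Library.Multiset"
begin

text \<open>Number fields are realised as subfields of the complex numbers of finite degree
  over the rationals; every abstract number field is isomorphic to one of these.\<close>

abbreviation complex_field :: "complex ring" where
  "complex_field \<equiv> ring_of_type_algebra"

definition number_field :: "complex set \<Rightarrow> bool" where
  "number_field K \<longleftrightarrow> subfield K complex_field \<and> ring.finite_dimension complex_field \<rat> K"

definition ring_of_integers :: "complex set \<Rightarrow> complex ring" where
  "ring_of_integers K = complex_field\<lparr>carrier := {x \<in> K. algebraic_int x}\<rparr>"

text \<open>By unique factorization, the primes dividing \<open>p\<O>\<^sub>K\<close> as ideals are exactly the distinct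
  \<open>P\<^sub>1, \<dots>, P\<^sub>n\<close> occurring in \<open>p\<O>\<^sub>K = P\<^sub>1\<^bsup>e\<^sub>1\<^esup> \<cdots> P\<^sub>n\<^bsup>e\<^sub>n\<^esup>\<close>; there are finitely many of them.\<close>

definition primes_over :: "complex set \<Rightarrow> nat \<Rightarrow> complex set set" where
  "primes_over K p =
     {P. primeideal P (ring_of_integers K) \<and>
         (\<exists>J. ideal J (ring_of_integers K) \<and>
              PIdl\<^bsub>ring_of_integers K\<^esub> (of_nat p) = P \<cdot>\<^bsub>ring_of_integers K\<^esub> J)}"

text \<open>The base field \<open>\<int>/p\<int>\<close> is the image of the integers in the residue field of \<open>P\<close>.\<close>

definition residual_degree :: "complex set \<Rightarrow> complex set \<Rightarrow> nat" where
  "residual_degree K P =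
     (let R = ring_of_integers K; k = R Quot P
      in ring.dim k (range (\<lambda>m :: int. P +>\<^bsub>R\<^esub> of_int m)) (carrier k))"

definition splitting_type :: "complex set \<Rightarrow> nat \<Rightarrow> nat multiset" where
  "splitting_type K p = image_mset (residual_degree K) (mset_set (primes_over K p))"

definition s_inv :: "nat \<Rightarrow> complex set \<Rightarrow> nat" where
  "s_inv p K = (if splitting_type K p = {#1#} then 1 else 0)"

end

theory Submission
  imports Defs
begin

text \<open>
  In a quadratic field a rational prime \<open>p\<close> either splits (type \<open>{1, 1}\<close>), is inert (type \<open>{2}\<close>)
  or ramifies (type \<open>{1}\<close>). Hence for such a field \<open>s\<close> takes the value \<open>1\<close> at the ramified primes
  only, a finite set: any two quadratic fields are equivalent for \<open>s\<close>, and any two with different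
  ramified primes have a non-empty exceptional set. The fields used are \<open>\<rat>(\<surd>-1)\<close> and
  \<open>\<rat>(\<surd>-3)\<close>, and \<open>3\<close> is an exceptional prime: it ramifies in the second field but not in the first.

  Two statements about \<open>K = \<rat>(\<surd>-n)\<close> with \<open>n > 0\<close> suffice.

  \<^item> If \<open>p\<close> does not divide \<open>2n\<close>, then \<open>s(p, K) = 0\<close> (\<open>s_inv_imag_quad_eq_0\<close>). Otherwise there is a
  unique prime \<open>P\<close> over \<open>p\<close>, its residue field is \<open>\<int>/p\<int>\<close>, and so \<open>\<surd>-n \<equiv> m\<close> modulo \<open>P\<close> for
  some integer \<open>m\<close>. By uniqueness \<open>P\<close> is stable under complex conjugation, whence also
  \<open>-\<surd>-n \<equiv> m\<close>. Adding the two congruences puts \<open>2m\<close>, hence \<open>m\<close>, hence \<open>\<surd>-n\<close>, hence \<open>n\<close> into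
  \<open>P\<close>; since \<open>P\<close> meets \<open>\<int>\<close> in \<open>p\<int>\<close>, this makes \<open>p\<close> a divisor of \<open>n\<close>.

  \<^item> If \<open>q\<close> is an odd prime and \<open>n = q\<close>, then \<open>s(q, K) = 1\<close> (\<open>s_inv_imag_quad_eq_1\<close>). The principal
  ideal \<open>P\<close> of \<open>\<surd>-q\<close> has square \<open>(q)\<close>, every integer of \<open>K\<close> is congruent to a rational integer
  modulo \<open>P\<close>, and every prime containing \<open>q\<close> contains \<open>\<surd>-q\<close> and therefore equals \<open>P\<close>.

  The integers of \<open>K\<close> are the elements with integral trace and norm
  (\<open>algebraic_int_imag_quad_iff\<close>). This follows from Gauss's lemma on contents, and it shows that
  they form a ring and bounds their denominators by \<open>2n\<close>.
\<close>

section \<open>Algebraic integers of degree two\<close>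

text \<open>Gauss's lemma in disguise. Let \<open>Q\<close> be the primitive integer polynomial proportional to
  \<open>X\<^sup>2 - T X + N\<close>, and let \<open>p\<close> be a monic integer polynomial vanishing at \<open>x\<close>. Pseudo-division of
  \<open>p\<close> by \<open>Q\<close> leaves a remainder of degree at most one that vanishes at the irrational \<open>x\<close>, so it is
  zero and \<open>a p = Q q\<close> for some integer \<open>a \<noteq> 0\<close>. Comparing contents gives \<open>\<bar>a\<bar> = content q\<close>;
  comparing leading coefficients then shows that the leading coefficient of \<open>Q\<close> is a unit.\<close>
lemma quadratic_algebraic_int_coeffs:
  fixes x T N :: "'a :: field_char_0"
  assumes x: "algebraic_int x" "x \<notin> \<rat>"
    and TN: "T \<in> \<rat>" "N \<in> \<rat>" "x ^ 2 - T * x + N = 0"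
  shows "T \<in> \<int>" "N \<in> \<int>"
proof -
  define ev where "ev p = poly (map_poly of_int p) x" for p :: "int poly"
  have ev_pCons [simp]: "ev (pCons a p) = of_int a + x * ev p" for a p
    by (simp add: ev_def map_poly_pCons)
  have ev_0 [simp]: "ev 0 = 0" by (simp add: ev_def)
  have ev_add: "ev (p + q) = ev p + ev q" for p q
  proof (induction p arbitrary: q)
    case (pCons a p)
    obtain b q' where "q = pCons b q'" by (rule pCons_cases)
    thus ?case using pCons.IH[of q'] by (simp add: algebra_simps)
  qed auto
  have ev_smult: "ev (Polynomial.smult c p) = of_int c * ev p" for c p
    by (induction p) (auto simp: algebra_simps)
  have ev_mult: "ev (p * q) = ev p * ev q" for p q
    by (induction p) (auto simp: ev_add ev_smult algebra_simps)
  obtain p where p: "ev p = 0" "Polynomial.lead_coeff p = 1"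
    using x(1) unfolding algebraic_int_altdef_ipoly ev_def by blast
  obtain t u where tu: "u > 0" "T = of_int t / of_int u"
    using TN(1) by (auto elim: Rats_cases')
  obtain v w where vw: "w > 0" "N = of_int v / of_int w"
    using TN(2) by (auto elim: Rats_cases')
  define Q0 where "Q0 = [:u * v, - (t * w), u * w:]"
  define Q where "Q = primitive_part Q0"
  define k where "k = content Q0"
  have Q0: "Q0 \<noteq> 0" "Polynomial.degree Q0 = 2" using tu vw by (auto simp: Q0_def)
  have k: "k \<noteq> 0" using Q0 by (simp add: k_def)
  have Q0_eq: "Q0 = Polynomial.smult k Q" by (simp add: Q_def k_def)
  have Q: "Polynomial.degree Q = 2" "Q \<noteq> 0" "content Q = 1"
    using Q0 by (auto simp: Q_def)
  have "ev Q0 = of_int (u * w) * (x ^ 2 - T * x + N)"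
    using tu vw by (simp add: Q0_def field_simps power2_eq_square)
  hence evQ: "ev Q = 0" using TN k by (simp add: Q0_eq ev_smult)
  define r where "r = pseudo_mod p Q"
  obtain a q where aq: "a \<noteq> 0" "Polynomial.smult a p = Q * q + r"
    using pseudo_mod(1)[OF Q(2), of p] by (auto simp: r_def)
  have "ev r = 0"
    using arg_cong[OF aq(2), of ev] p evQ by (simp add: ev_smult ev_add ev_mult)
  have "r = 0"
  proof -
    have "Polynomial.degree r < 2" using pseudo_mod(2)[OF Q(2), of p] Q by (auto simp: r_def)
    hence r_eq: "r = [:poly.coeff r 0, poly.coeff r 1:]"
      by (intro poly_eqI) (auto simp: coeff_pCons coeff_eq_0 split: nat.splits)
    then obtain r0 r1 where r: "r = [:r0, r1:]" by blast
    hence eq: "of_int r0 + x * of_int r1 = 0" using \<open>ev r = 0\<close> by simp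
    have "r1 = 0"
    proof (rule ccontr)
      assume "r1 \<noteq> 0"
      hence "x = - of_int r0 / of_int r1" using eq by (simp add: field_simps add_eq_0_iff)
      thus False using x(2) by simp
    qed
    thus ?thesis using eq r by simp
  qed
  have lc: "a = Polynomial.lead_coeff Q * Polynomial.lead_coeff q"
    using arg_cong[OF aq(2), of Polynomial.lead_coeff] \<open>r = 0\<close> p aq(1)
    by (simp add: Polynomial.lead_coeff_mult)
  have "content p = 1"
    by (metis content_dvd_coeff is_unit_content_iff p(2))
  hence "content q = normalize a"
    using arg_cong[OF aq(2), of content] \<open>r = 0\<close> Q by (simp add: content_mult)
  hence "a dvd Polynomial.lead_coeff q"
    by (metis content_dvd_coeff normalize_dvd_iff)
  then obtain b where "Polynomial.lead_coeff q = a * b" by blast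
  hence "a * (Polynomial.lead_coeff Q * b) = a * 1" using lc by (simp add: algebra_simps)
  hence "Polynomial.lead_coeff Q * b = 1" using aq(1) by (simp only: mult_cancel_left) simp
  hence "Polynomial.lead_coeff Q dvd 1" by (rule dvdI[OF sym])
  hence unit: "\<bar>poly.coeff Q 2\<bar> = 1" using Q by (simp add: numeral_2_eq_2)
  have c: "u * v = k * poly.coeff Q 0" "- (t * w) = k * poly.coeff Q 1" "u * w = k * poly.coeff Q 2"
    using arg_cong[OF Q0_eq, of "\<lambda>p. poly.coeff p 0"] arg_cong[OF Q0_eq, of "\<lambda>p. poly.coeff p 1"]
      arg_cong[OF Q0_eq, of "\<lambda>p. poly.coeff p 2"]
    by (simp_all add: Q0_def numeral_2_eq_2)
  \<comment> \<open>The leading coefficient of \<open>Q0\<close> is now the content of \<open>Q0\<close> up to sign, so it divides the others.\<close>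
  have uw: "u * w = k \<or> u * w = - k" using c(3) unit by (auto simp: abs_if split: if_splits)
  have "T = of_int (t * w) / of_int (u * w)" "N = of_int (u * v) / of_int (u * w)"
    using tu vw by simp_all
  moreover have "k dvd - (t * w)" "k dvd u * v" by (simp_all only: c dvd_triv_left)
  hence "u * w dvd t * w" "u * w dvd u * v" using uw by (metis dvd_minus_iff minus_dvd_iff)+
  ultimately show "T \<in> \<int>" "N \<in> \<int>"
    by (metis of_int_divide_in_Ints)+
qed

lemma quadratic_algebraic_int:
  fixes x b c :: "'a :: field_char_0"
  assumes "x ^ 2 + b * x + c = 0" "b \<in> \<int>" "c \<in> \<int>"
  shows "algebraic_int x"
proof (rule algebraic_int.intros[of "[:c, b, 1:]"])
  show "\<forall>i. poly.coeff [:c, b, 1:] i \<in> \<int>"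
    using assms by (auto simp: coeff_pCons split: nat.splits)
  show "poly [:c, b, 1:] x = 0" using assms(1) by (simp add: algebra_simps power2_eq_square)
qed auto

section \<open>The field generated by a square root of \<open>-n\<close>\<close>

definition sqrt_neg :: "nat \<Rightarrow> complex" where
  "sqrt_neg n = \<i> * complex_of_real (sqrt (real n))"

definition imag_quad :: "nat \<Rightarrow> complex set" where
  "imag_quad n = {a + b * sqrt_neg n | a b. a \<in> \<rat> \<and> b \<in> \<rat>}"

lemma imag_quadI: "a \<in> \<rat> \<Longrightarrow> b \<in> \<rat> \<Longrightarrow> a + b * sqrt_neg n \<in> imag_quad n"
  by (auto simp: imag_quad_def)

lemma sqrt_neg_sq: "sqrt_neg n * sqrt_neg n = - of_nat n"
  by (simp add: sqrt_neg_def algebra_simps flip: of_real_mult)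

lemma cnj_sqrt_neg [simp]: "cnj (sqrt_neg n) = - sqrt_neg n"
  by (simp add: sqrt_neg_def)

lemma cnj_Rats: "a \<in> \<rat> \<Longrightarrow> cnj a = a"
  by (auto elim!: Rats_cases')

lemma cnj_imag_quad [simp]: "cnj x \<in> imag_quad n \<longleftrightarrow> x \<in> imag_quad n"
proof -
  have *: "cnj x \<in> imag_quad n" if x: "x \<in> imag_quad n" for x
  proof -
    obtain a b where ab: "a \<in> \<rat>" "b \<in> \<rat>" "x = a + b * sqrt_neg n"
      using x by (auto simp: imag_quad_def)
    hence "cnj x = a + (- b) * sqrt_neg n" by (simp add: cnj_Rats)
    thus ?thesis using imag_quadI[of a "-b" n] ab by simp
  qed
  show ?thesis using *[of x] *[of "cnj x"] by auto
qed

lemma Rats_subset_imag_quad: "a \<in> \<rat> \<Longrightarrow> a \<in> imag_quad n"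
  using imag_quadI[of a 0 n] by simp

lemma imag_quad_add:
  assumes "x \<in> imag_quad n" "y \<in> imag_quad n" shows "x + y \<in> imag_quad n"
proof -
  obtain a b c d where ab: "a \<in> \<rat>" "b \<in> \<rat>" "x = a + b * sqrt_neg n"
    and cd: "c \<in> \<rat>" "d \<in> \<rat>" "y = c + d * sqrt_neg n"
    using assms by (auto simp: imag_quad_def)
  have "x + y = (a + c) + (b + d) * sqrt_neg n" by (simp add: ab cd algebra_simps)
  also have "\<dots> \<in> imag_quad n" by (rule imag_quadI) (use ab cd in auto)
  finally show ?thesis .
qed

lemma imag_quad_mult:
  assumes "x \<in> imag_quad n" "y \<in> imag_quad n" shows "x * y \<in> imag_quad n"
proof -
  obtain a b c d where ab: "a \<in> \<rat>" "b \<in> \<rat>" "x = a + b * sqrt_neg n"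
    and cd: "c \<in> \<rat>" "d \<in> \<rat>" "y = c + d * sqrt_neg n"
    using assms by (auto simp: imag_quad_def)
  have "x * y = a * c + b * d * (sqrt_neg n * sqrt_neg n) + (a * d + b * c) * sqrt_neg n"
    by (simp add: ab cd algebra_simps)
  also have "\<dots> = (a * c - of_nat n * b * d) + (a * d + b * c) * sqrt_neg n"
    by (simp only: sqrt_neg_sq) (simp add: algebra_simps)
  finally show ?thesis
    using imag_quadI[of "a * c - of_nat n * b * d" "a * d + b * c"] ab cd by simp
qed

lemma imag_quad_uminus: "x \<in> imag_quad n \<Longrightarrow> - x \<in> imag_quad n"
  using imag_quad_mult[of "-1" n x] by (simp add: Rats_subset_imag_quad)

lemma imag_quad_trace_norm_Rats:
  assumes "x \<in> imag_quad n"
  shows "x + cnj x \<in> \<rat>" "x * cnj x \<in> \<rat>"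
proof -
  obtain a b where ab: "a \<in> \<rat>" "b \<in> \<rat>" "x = a + b * sqrt_neg n"
    using assms by (auto simp: imag_quad_def)
  have cx: "cnj x = a - b * sqrt_neg n" using ab by (simp add: cnj_Rats)
  show "x + cnj x \<in> \<rat>" using ab unfolding cx by simp
  have "x * cnj x = a * a - b * b * (sqrt_neg n * sqrt_neg n)"
    unfolding cx by (simp add: ab(3) algebra_simps)
  also have "\<dots> = a * a + of_nat n * b * b" by (simp only: sqrt_neg_sq) simp
  finally show "x * cnj x \<in> \<rat>" using ab by simp
qed

lemma complex_field_simps [simp]:
  "carrier complex_field = UNIV" "x \<otimes>\<^bsub>complex_field\<^esub> y = x * y"
  "x \<oplus>\<^bsub>complex_field\<^esub> y = x + y" "\<zero>\<^bsub>complex_field\<^esub> = 0" "\<one>\<^bsub>complex_field\<^esub> = 1"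
  by (simp_all add: ring_of_type_algebra_def)

lemma complex_field_a_inv [simp]: "\<ominus>\<^bsub>complex_field\<^esub> x = - (x :: complex)"
proof -
  interpret field complex_field by (rule field_from_type_algebra)
  show ?thesis using minus_equality[of "-x" x] by simp
qed

lemma complex_field_inv:
  assumes "x \<noteq> 0" shows "inv\<^bsub>complex_field\<^esub> x = inverse (x :: complex)"
proof -
  interpret field complex_field by (rule field_from_type_algebra)
  show ?thesis using assms by (intro comm_inv_char) auto
qed

text \<open>The closure conditions in terms of the type class operations on the complex numbers, so that
  they can be checked without reference to the record of ring operations.\<close>
lemma subfield_complexI:
  assumes "1 \<in> K" and "\<And>x. x \<in> K \<Longrightarrow> - x \<in> K" and "\<And>x y. x \<in> K \<Longrightarrow> y \<in> K \<Longrightarrow> x + y \<in> K"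
    and "\<And>x y. x \<in> K \<Longrightarrow> y \<in> K \<Longrightarrow> x * y \<in> K" and "\<And>x. x \<in> K \<Longrightarrow> x \<noteq> 0 \<Longrightarrow> inverse x \<in> K"
  shows "subfield K complex_field"
proof -
  interpret field complex_field by (rule field_from_type_algebra)
  show ?thesis
    by (intro subfieldI' subringI) (use assms complex_field_inv in auto)
qed

lemma imag_quad_inverse:
  assumes "x \<in> imag_quad n" shows "inverse x \<in> imag_quad n"
proof -
  have "inverse x = inverse (x * cnj x) * cnj x" by (simp add: field_simps)
  also have "\<dots> \<in> imag_quad n"
  proof (rule imag_quad_mult)
    show "inverse (x * cnj x) \<in> imag_quad n"
      using imag_quad_trace_norm_Rats(2)[OF assms] by (intro Rats_subset_imag_quad Rats_inverse)
  qed (use assms in simp)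
  finally show ?thesis .
qed

lemma number_field_imag_quad: "number_field (imag_quad n)"
proof -
  interpret field complex_field by (rule field_from_type_algebra)
  have Q: "subfield \<rat> complex_field" by (rule subfield_complexI) auto
  have "subfield (imag_quad n) complex_field"
    by (rule subfield_complexI)
      (use imag_quad_add imag_quad_mult imag_quad_uminus imag_quad_inverse
        Rats_subset_imag_quad[of 1] in auto)
  moreover have "x \<in> Span \<rat> [1, sqrt_neg n] \<longleftrightarrow> x \<in> imag_quad n" for x
    by (simp add: imag_quad_def line_extension_mem_iff Bex_def) blast
  hence "Span \<rat> [1, sqrt_neg n] = imag_quad n" by blast
  ultimately show ?thesis
    unfolding number_field_def using Span_finite_dimension[OF Q, of "[1, sqrt_neg n]"] by simp
qed

section \<open>The ring of integers, by trace and norm\<close>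

text \<open>For \<open>n > 0\<close> complex conjugation is the non-trivial automorphism of the field, so \<open>x + cnj x\<close> and
  \<open>x * cnj x\<close> are the trace and the norm of \<open>x\<close>, and \<open>x\<close> is a root of the quadratic polynomial
  that they define.\<close>
lemma algebraic_int_imag_quad_iff:
  assumes "x \<in> imag_quad n"
  shows "algebraic_int x \<longleftrightarrow> x + cnj x \<in> \<int> \<and> x * cnj x \<in> \<int>"
proof
  assume x: "algebraic_int x"
  show "x + cnj x \<in> \<int> \<and> x * cnj x \<in> \<int>"
  proof (cases "x \<in> \<rat>")
    case True
    hence "x \<in> \<int>" using x rational_algebraic_int_is_int by blast
    thus ?thesis using cnj_Rats[OF True] by simp
  next
    case False
    have "x ^ 2 - (x + cnj x) * x + x * cnj x = 0" by (simp add: power2_eq_square algebra_simps)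
    thus ?thesis
      using quadratic_algebraic_int_coeffs[OF x False] imag_quad_trace_norm_Rats[OF assms] by blast
  qed
next
  assume *: "x + cnj x \<in> \<int> \<and> x * cnj x \<in> \<int>"
  have "x ^ 2 + (- (x + cnj x)) * x + x * cnj x = 0" by (simp add: power2_eq_square algebra_simps)
  thus "algebraic_int x"
    by (rule quadratic_algebraic_int) (use * in \<open>auto intro: Ints_minus simp del: minus_add_distrib\<close>)
qed

text \<open>This is what makes the integers closed under addition and multiplication: the norm of a sum
  involves the trace of \<open>x * cnj y\<close>, and the trace of a product that of \<open>x * y\<close>. These two
  traces are the roots of a single monic quadratic polynomial whose coefficients are integer
  polynomials in the traces and norms of \<open>x\<close> and \<open>y\<close>. Being rational algebraic integers, they are
  integers.\<close>
lemma cross_trace_int: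
  assumes K: "x \<in> imag_quad n" "y \<in> imag_quad n" and "algebraic_int x" "algebraic_int y"
  shows "x * y + cnj (x * y) \<in> \<int>" "x * cnj y + cnj (x * cnj y) \<in> \<int>"
proof -
  have T: "x + cnj x \<in> \<int>" "y + cnj y \<in> \<int>" and N: "x * cnj x \<in> \<int>" "y * cnj y \<in> \<int>"
    using assms algebraic_int_imag_quad_iff by blast+
  \<comment> \<open>\<open>u\<close> and \<open>b - u\<close> are the two traces, \<open>b\<close> is their sum and \<open>c\<close> their product.\<close>
  define u where "u = x * y + cnj (x * y)"
  define b where "b = (x + cnj x) * (y + cnj y)"
  define c where "c = (y * cnj y) * ((x + cnj x) ^ 2 - 2 * (x * cnj x))
    + (x * cnj x) * ((y + cnj y) ^ 2 - 2 * (y * cnj y))"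
  have bc: "b \<in> \<int>" "c \<in> \<int>" using T N by (auto simp: b_def c_def)
  have "u ^ 2 + (- b) * u + c = 0"
    by (simp add: u_def b_def c_def power2_eq_square algebra_simps)
  hence "algebraic_int u" using bc by (intro quadratic_algebraic_int[of u "-b" c]) auto
  moreover have "u \<in> \<rat>"
    unfolding u_def by (rule imag_quad_trace_norm_Rats imag_quad_mult K)+
  ultimately show "x * y + cnj (x * y) \<in> \<int>"
    unfolding u_def by (rule rational_algebraic_int_is_int)
  moreover have "x * cnj y + cnj (x * cnj y) = b - u"
    by (simp add: b_def u_def algebra_simps)
  ultimately show "x * cnj y + cnj (x * cnj y) \<in> \<int>" using bc u_def by simp
qed

definition quad_ints :: "nat \<Rightarrow> complex set" where "quad_ints n = {x \<in> imag_quad n. algebraic_int x}"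

lemma quad_ints_iff: "x \<in> quad_ints n \<longleftrightarrow> x \<in> imag_quad n \<and> x + cnj x \<in> \<int> \<and> x * cnj x \<in> \<int>"
  using algebraic_int_imag_quad_iff by (auto simp: quad_ints_def)

lemma quad_intsD:
  assumes "x \<in> quad_ints n"
  shows "x \<in> imag_quad n" "algebraic_int x" "x + cnj x \<in> \<int>" "x * cnj x \<in> \<int>"
proof -
  show x: "x \<in> imag_quad n" "algebraic_int x" using assms by (simp_all add: quad_ints_def)
  have "x + cnj x \<in> \<int> \<and> x * cnj x \<in> \<int>" using iffD1[OF algebraic_int_imag_quad_iff, OF x] .
  thus "x + cnj x \<in> \<int>" "x * cnj x \<in> \<int>" by (rule conjunct1, rule conjunct2)
qed

lemma quad_ints_add: assumes "x \<in> quad_ints n" "y \<in> quad_ints n" shows "x + y \<in> quad_ints n"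
proof -
  note x = quad_intsD[OF assms(1)] and y = quad_intsD[OF assms(2)]
  have "(x + y) + cnj (x + y) = (x + cnj x) + (y + cnj y)" by simp
  also have "\<dots> \<in> \<int>" by (rule Ints_add[OF x(3) y(3)])
  finally have T: "(x + y) + cnj (x + y) \<in> \<int>" .
  have "(x + y) * cnj (x + y) = x * cnj x + y * cnj y + (x * cnj y + cnj (x * cnj y))"
    by (simp add: algebra_simps)
  also have "\<dots> \<in> \<int>"
    by (rule Ints_add[OF Ints_add[OF x(4) y(4)] cross_trace_int(2)[OF x(1) y(1) x(2) y(2)]])
  finally have "(x + y) * cnj (x + y) \<in> \<int>" .
  with T show ?thesis unfolding quad_ints_iff using imag_quad_add[OF x(1) y(1)] by (intro conjI)
qed

lemma quad_ints_mult: assumes "x \<in> quad_ints n" "y \<in> quad_ints n" shows "x * y \<in> quad_ints n"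
proof -
  note x = quad_intsD[OF assms(1)] and y = quad_intsD[OF assms(2)]
  have "(x * y) * cnj (x * y) = (x * cnj x) * (y * cnj y)"
    by (simp add: algebra_simps)
  also have "\<dots> \<in> \<int>" by (rule Ints_mult[OF x(4) y(4)])
  finally have "(x * y) * cnj (x * y) \<in> \<int>" .
  with cross_trace_int(1)[OF x(1) y(1) x(2) y(2)] show ?thesis
    unfolding quad_ints_iff using imag_quad_mult[OF x(1) y(1)] by (intro conjI)
qed

lemma quad_ints_Ints: "x \<in> \<int> \<Longrightarrow> x \<in> quad_ints n"
  by (auto simp: quad_ints_def int_imp_algebraic_int Rats_subset_imag_quad elim!: Ints_cases)

lemma quad_ints_uminus: "x \<in> quad_ints n \<Longrightarrow> - x \<in> quad_ints n"
  using quad_ints_mult[of "-1" n x] quad_ints_Ints[of "-1" n] by simp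

lemma quad_ints_cnj: "x \<in> quad_ints n \<Longrightarrow> cnj x \<in> quad_ints n"
  by (simp add: quad_ints_def)

lemma quad_ints_sqrt_neg: "sqrt_neg n \<in> quad_ints n"
proof -
  have "sqrt_neg n * cnj (sqrt_neg n) = - (sqrt_neg n * sqrt_neg n)" by simp
  also have "\<dots> \<in> \<int>" by (simp only: sqrt_neg_sq) simp
  finally have "sqrt_neg n * cnj (sqrt_neg n) \<in> \<int>" .
  moreover have "sqrt_neg n \<in> imag_quad n" using imag_quadI[of 0 1 n] by simp
  ultimately show ?thesis by (simp add: quad_ints_iff)
qed

abbreviation quad_ring :: "nat \<Rightarrow> complex ring" where "quad_ring n \<equiv> ring_of_integers (imag_quad n)"

lemma quad_ring_simps [simp]:
  "carrier (quad_ring n) = quad_ints n" "x \<otimes>\<^bsub>quad_ring n\<^esub> y = x * y" "x \<oplus>\<^bsub>quad_ring n\<^esub> y = x + y" "\<zero>\<^bsub>quad_ring n\<^esub> = 0" "\<one>\<^bsub>quad_ring n\<^esub> = 1"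
  by (simp_all add: ring_of_integers_def ring_of_type_algebra_def quad_ints_def)

lemma quad_ring_cring: "cring (quad_ring n)"
proof -
  interpret field complex_field by (rule field_from_type_algebra)
  have "subcring (quad_ints n) complex_field"
    by (intro subcringI' subringI) (simp_all add: quad_ints_add quad_ints_mult quad_ints_Ints quad_ints_uminus)
  thus ?thesis
    by (subst (asm) subcring_iff) (simp_all add: ring_of_integers_def quad_ints_def)
qed

lemma quad_ring_a_inv [simp]: "x \<in> quad_ints n \<Longrightarrow> \<ominus>\<^bsub>quad_ring n\<^esub> x = - x"
proof -
  interpret cring "quad_ring n" by (rule quad_ring_cring)
  assume "x \<in> quad_ints n"
  thus ?thesis using minus_equality[of "-x" x] quad_ints_uminus[of x n] by simp
qed

section \<open>Ideals above a rational prime\<close>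

lemma quad_ideal_closed:
  assumes "ideal P (quad_ring n)"
  shows "x \<in> P \<Longrightarrow> y \<in> P \<Longrightarrow> x + y \<in> P" "x \<in> P \<Longrightarrow> - x \<in> P" "x \<in> P \<Longrightarrow> y \<in> P \<Longrightarrow> x - y \<in> P"
    "x \<in> P \<Longrightarrow> y \<in> quad_ints n \<Longrightarrow> y * x \<in> P" "x \<in> P \<Longrightarrow> x \<in> quad_ints n"
proof -
  interpret ideal P "quad_ring n" by fact
  show add: "x \<in> P \<Longrightarrow> y \<in> P \<Longrightarrow> x + y \<in> P" for x y
    using additive_subgroup.a_closed[OF additive_subgroup_axioms, of x y] by simp
  show in_ints: "x \<in> P \<Longrightarrow> x \<in> quad_ints n" for x using Icarr[of x] by simp
  show mult: "x \<in> P \<Longrightarrow> y \<in> quad_ints n \<Longrightarrow> y * x \<in> P" for x y using I_l_closed[of x y] by simp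
  show minus: "x \<in> P \<Longrightarrow> - x \<in> P" for x using mult[of x "-1"] by (simp add: quad_ints_Ints)
  show "x \<in> P \<Longrightarrow> y \<in> P \<Longrightarrow> x - y \<in> P" using add[of x "-y"] minus[of y] by simp
qed

text \<open>A proper ideal containing \<open>p\<close> meets \<open>\<int>\<close> exactly in \<open>p\<int>\<close>, because an integer prime to \<open>p\<close>
  would, by Bezout, bring \<open>1\<close> into the ideal.\<close>
lemma of_int_mem_quad_ideal_iff:
  assumes P: "ideal P (quad_ring n)" and "1 \<notin> P" and p: "Factorial_Ring.prime p" "of_nat p \<in> P"
  shows "of_int m \<in> P \<longleftrightarrow> int p dvd m"
proof
  assume "int p dvd m"
  then obtain t where "m = t * int p" by (metis dvdE mult.commute)
  hence "of_int m = of_int t * (of_nat p :: complex)" by simp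
  thus "of_int m \<in> P" using quad_ideal_closed(4)[OF P p(2), of "of_int t"] by (simp add: quad_ints_Ints)
next
  assume m: "of_int m \<in> P"
  show "int p dvd m"
  proof (rule ccontr)
    assume "\<not> int p dvd m"
    hence "Rings.coprime (int p) m" using p(1) by (simp add: prime_imp_coprime)
    then obtain u v where "u * int p + v * m = 1"
      using bezout_int[of "int p" m] by (auto simp: coprime_iff_gcd_eq_1)
    hence "(of_int (u * int p + v * m) :: complex) = of_int 1" by (simp only:)
    hence "1 = of_int u * of_nat p + of_int v * (of_int m :: complex)" by simp
    also have "\<dots> \<in> P" by (intro quad_ideal_closed[OF P] m p quad_ints_Ints) auto
    finally show False using assms by blast
  qed
qed

lemma primeideal_quad_ringD:
  assumes "primeideal P (quad_ring n)"
  shows "ideal P (quad_ring n)" "1 \<notin> P"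
proof -
  interpret primeideal P "quad_ring n" by fact
  show "ideal P (quad_ring n)" by (rule is_ideal)
  show "1 \<notin> P" using one_imp_carrier I_notcarr by auto
qed

lemma prime_over_props:
  assumes "P \<in> primes_over (imag_quad n) p"
  shows "primeideal P (quad_ring n)" "ideal P (quad_ring n)" "1 \<notin> P" "of_nat p \<in> P"
proof -
  interpret cring "quad_ring n" by (rule quad_ring_cring)
  obtain J where J: "primeideal P (quad_ring n)" "ideal J (quad_ring n)"
    "PIdl\<^bsub>quad_ring n\<^esub> (of_nat p) = P \<cdot>\<^bsub>quad_ring n\<^esub> J"
    using assms(1) by (auto simp: primes_over_def)
  show "primeideal P (quad_ring n)" by fact
  show P: "ideal P (quad_ring n)" and "1 \<notin> P"
    using primeideal_quad_ringD[OF J(1)] by blast+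
  have "of_nat p \<in> PIdl\<^bsub>quad_ring n\<^esub> (of_nat p)" by (rule cgenideal_self) (simp add: quad_ints_Ints)
  thus "of_nat p \<in> P" using ideal_prod_inter[OF P J(2)] J(3) by blast
qed

text \<open>The prime field \<open>\<int>/p\<int>\<close> inside the residue field of \<open>P\<close>, over which residual degrees are
  measured.\<close>
definition int_residues :: "nat \<Rightarrow> complex set \<Rightarrow> complex set set" where
  "int_residues n P = range (\<lambda>m :: int. P +>\<^bsub>quad_ring n\<^esub> of_int m)"

lemma coset_eq_iff:
  assumes "ideal P (quad_ring n)" "x \<in> quad_ints n" "y \<in> quad_ints n"
  shows "P +>\<^bsub>quad_ring n\<^esub> x = P +>\<^bsub>quad_ring n\<^esub> y \<longleftrightarrow> x - y \<in> P"
proof -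
  interpret cring "quad_ring n" by (rule quad_ring_cring)
  show ?thesis
    using quotient_eq_iff_same_a_r_cos[OF assms(1), of x y] assms by (auto simp: a_minus_def)
qed

text \<open>Dimensions over this set of residues are well behaved only once it is known to be a subfield.
  Inverses come from Bezout: the class of \<open>m\<close> is non-zero only if \<open>p\<close> does not divide \<open>m\<close>.\<close>
lemma int_residues_subfield:
  assumes prime: "primeideal P (quad_ring n)"
    and p: "Factorial_Ring.prime p" "of_nat p \<in> P"
  shows "subfield (int_residues n P) (quad_ring n Quot P)"
proof -
  let ?R = "quad_ring n" and ?k = "quad_ring n Quot P"
  note P = primeideal_quad_ringD[OF prime]
  define h where "h = (\<lambda>x. P +>\<^bsub>?R\<^esub> x)"
  interpret R: cring ?R by (rule quad_ring_cring)
  interpret P: primeideal P ?R by (rule prime)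
  interpret k: domain ?k by (rule P.quotient_is_domain)
  interpret h: ring_hom_ring ?R ?k h unfolding h_def by (rule P.rcos_ring_hom_ring)
  have F: "int_residues n P = h ` \<int>"
    by (auto simp: int_residues_def h_def Ints_def)
  have Z: "subring \<int> ?R"
    by (rule R.subringI) (auto simp: quad_ints_Ints)
  have sub: "subring (h ` \<int>) ?k" by (rule h.img_is_subring[OF Z])
  have "Units (?k\<lparr>carrier := h ` \<int>\<rparr>) = h ` \<int> - {\<zero>\<^bsub>?k\<^esub>}"
  proof (intro equalityI subsetI)
    fix x assume "x \<in> Units (?k\<lparr>carrier := h ` \<int>\<rparr>)"
    then obtain y where y: "x \<in> h ` \<int>" "y \<in> h ` \<int>" "x \<otimes>\<^bsub>?k\<^esub> y = \<one>\<^bsub>?k\<^esub>"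
      by (auto simp: Units_def)
    hence "x \<in> carrier ?k" "y \<in> carrier ?k" using subringE(1)[OF sub] by blast+
    thus "x \<in> h ` \<int> - {\<zero>\<^bsub>?k\<^esub>}" using y by auto
  next
    fix x assume x: "x \<in> h ` \<int> - {\<zero>\<^bsub>?k\<^esub>}"
    then obtain m where m: "x = h (of_int m)" by (auto elim!: Ints_cases)
    have "h (of_int m) \<noteq> h 0" using x m h.hom_zero by auto
    hence "\<not> int p dvd m"
      using of_int_mem_quad_ideal_iff[OF P p] coset_eq_iff[OF P(1), of "of_int m" 0]
      by (auto simp: h_def quad_ints_Ints)
    hence "Rings.coprime (int p) m" using p(1) by (simp add: prime_imp_coprime)
    then obtain v u where "v * int p + u * m = 1"
      using bezout_int[of "int p" m] by (auto simp: coprime_iff_gcd_eq_1)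
    hence "m * u - 1 = int p * (- v)" by (simp add: algebra_simps)
    hence "int p dvd m * u - 1" by (rule dvdI)
    hence "of_int (m * u - 1) \<in> P" using of_int_mem_quad_ideal_iff[OF P p] by blast
    hence "h (of_int (m * u)) = h 1"
      unfolding h_def using P(1) by (subst coset_eq_iff) (auto simp: quad_ints_Ints)
    moreover have "h (of_int (m * u)) = x \<otimes>\<^bsub>?k\<^esub> h (of_int u)"
      using h.hom_mult[of "of_int m" "of_int u"] m by (simp add: quad_ints_Ints)
    ultimately have *: "x \<otimes>\<^bsub>?k\<^esub> h (of_int u) = \<one>\<^bsub>?k\<^esub>" using h.hom_one by simp
    have carr: "h (of_int u) \<in> carrier ?k" "x \<in> carrier ?k"
      using m by (simp_all add: quad_ints_Ints)
    have "h (of_int u) \<otimes>\<^bsub>?k\<^esub> x = \<one>\<^bsub>?k\<^esub>"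
      using * k.m_comm[OF carr(2,1)] by simp
    moreover have "h (of_int u) \<in> h ` \<int>" by (rule imageI) simp
    moreover have "x \<in> h ` \<int>" using x by blast
    ultimately show "x \<in> Units (?k\<lparr>carrier := h ` \<int>\<rparr>)"
      using * unfolding Units_def partial_object.simps monoid.simps by auto
  qed
  thus ?thesis unfolding F
    by (intro k.subfieldI k.subcringI' sub)
qed

lemma quad_idealI:
  assumes sub: "I \<subseteq> quad_ints n" and z0: "0 \<in> I"
    and add: "\<And>x y. x \<in> I \<Longrightarrow> y \<in> I \<Longrightarrow> x + y \<in> I"
    and mult: "\<And>x y. x \<in> I \<Longrightarrow> y \<in> quad_ints n \<Longrightarrow> y * x \<in> I"
  shows "ideal I (quad_ring n)"
proof -
  interpret cring "quad_ring n" by (rule quad_ring_cring)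
  have minus: "- x \<in> I" if "x \<in> I" for x using mult[OF that, of "-1"] by (simp add: quad_ints_Ints)
  show ?thesis
  proof (rule idealI)
    show "subgroup I (add_monoid (quad_ring n))"
    proof (rule subgroup.intro)
      show "inv\<^bsub>add_monoid (quad_ring n)\<^esub> x \<in> I" if "x \<in> I" for x
        using minus[OF that] quad_ring_a_inv[of x n] sub that by (auto simp: a_inv_def)
    qed (use sub z0 add in auto)
  qed (use mult ring_axioms in \<open>auto simp: mult.commute\<close>)
qed

text \<open>Conjugation is an automorphism of the ring of integers that fixes \<open>p\<close>, and so it transports
  a factorization \<open>(p) = P J\<close> to another one.\<close>
lemma primes_over_cnj:
  assumes "P \<in> primes_over (imag_quad n) p"
  shows "cnj -` P \<in> primes_over (imag_quad n) p"
proof -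
  interpret cring "quad_ring n" by (rule quad_ring_cring)
  have ideal: "ideal (cnj -` I) (quad_ring n)" if "ideal I (quad_ring n)" for I
  proof (rule quad_idealI)
    note I = quad_ideal_closed[OF that]
    show "cnj -` I \<subseteq> quad_ints n" using I(5) quad_ints_cnj by fastforce
    show "0 \<in> cnj -` I" using additive_subgroup.zero_closed[OF ideal.axioms(1)[OF that]] by simp
    show "x + y \<in> cnj -` I" if "x \<in> cnj -` I" "y \<in> cnj -` I" for x y
      using I(1) that by simp
    show "y * x \<in> cnj -` I" if "x \<in> cnj -` I" "y \<in> quad_ints n" for x y
      using I(4) that quad_ints_cnj by simp
  qed
  obtain J where J: "primeideal P (quad_ring n)" "ideal J (quad_ring n)"
    "PIdl\<^bsub>quad_ring n\<^esub> (of_nat p) = P \<cdot>\<^bsub>quad_ring n\<^esub> J"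
    using assms(1) by (auto simp: primes_over_def)
  interpret P: primeideal P "quad_ring n" by (rule J(1))
  have prime: "primeideal (cnj -` P) (quad_ring n)"
  proof (rule primeidealI)
    show "ideal (cnj -` P) (quad_ring n)" by (rule ideal) (rule P.is_ideal)
    have "1 \<notin> P" using primeideal_quad_ringD(2)[OF J(1)] .
    hence "1 \<notin> cnj -` P" by simp
    thus "carrier (quad_ring n) \<noteq> cnj -` P" using quad_ints_Ints[of 1 n] by auto
    show "a \<in> cnj -` P \<or> b \<in> cnj -` P" if "a \<in> carrier (quad_ring n)" "b \<in> carrier (quad_ring n)"
      "a \<otimes>\<^bsub>quad_ring n\<^esub> b \<in> cnj -` P" for a b
      using P.I_prime[of "cnj a" "cnj b"] that quad_ints_cnj by simp
  qed (rule quad_ring_cring)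
  \<comment> \<open>Conjugation is an involution, so this one inclusion gives both directions of the factorization.\<close>
  have prod: "cnj x \<in> (cnj -` A) \<cdot>\<^bsub>quad_ring n\<^esub> (cnj -` B)" if "x \<in> A \<cdot>\<^bsub>quad_ring n\<^esub> B" for A B x
    using that
  proof (induction rule: ideal_prod.induct)
    case (prod i j)
    thus ?case using ideal_prod.prod[of "cnj i" "cnj -` A" "cnj j" "cnj -` B" "quad_ring n"] by simp
  next
    case (sum x y)
    thus ?case using ideal_prod.sum[of "cnj x" "quad_ring n" "cnj -` A" "cnj -` B" "cnj y"] by simp
  qed
  have cnj_PIdl: "cnj x \<in> PIdl\<^bsub>quad_ring n\<^esub> (of_nat p)" if "x \<in> PIdl\<^bsub>quad_ring n\<^esub> (of_nat p)" for x
    using that quad_ints_cnj by (fastforce simp: cgenideal_def)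
  have "PIdl\<^bsub>quad_ring n\<^esub> (of_nat p) = (cnj -` P) \<cdot>\<^bsub>quad_ring n\<^esub> (cnj -` J)"
  proof (intro equalityI subsetI)
    fix x assume "x \<in> PIdl\<^bsub>quad_ring n\<^esub> (of_nat p)"
    from cnj_PIdl[OF this] have "cnj x \<in> P \<cdot>\<^bsub>quad_ring n\<^esub> J" by (simp only: J)
    from prod[OF this] show "x \<in> (cnj -` P) \<cdot>\<^bsub>quad_ring n\<^esub> (cnj -` J)" by simp
  next
    fix x assume "x \<in> (cnj -` P) \<cdot>\<^bsub>quad_ring n\<^esub> (cnj -` J)"
    from prod[OF this] have "cnj x \<in> PIdl\<^bsub>quad_ring n\<^esub> (of_nat p)"
      by (simp add: J vimage_comp o_def)
    from cnj_PIdl[OF this] show "x \<in> PIdl\<^bsub>quad_ring n\<^esub> (of_nat p)" by simp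
  qed
  thus ?thesis using prime ideal[OF J(2)] unfolding primes_over_def by blast
qed

section \<open>Unramified primes\<close>

text \<open>For \<open>x = a + b\<surd>-n\<close> with rational \<open>a\<close> and \<open>b\<close>, the traces of \<open>x\<close> and of \<open>x\<surd>-n\<close> are
  \<open>2a\<close> and \<open>-2nb\<close>; both are integers. This bounds the denominators of integers of the field by
  \<open>2n\<close>.\<close>
lemma quad_ints_trace_coords:
  assumes "x \<in> quad_ints n"
  obtains A C :: int where "of_nat (2 * n) * x = of_int (int n * A) + of_int C * sqrt_neg n"
proof -
  obtain a b where ab: "a \<in> \<rat>" "b \<in> \<rat>" "x = a + b * sqrt_neg n"
    using quad_intsD(1)[OF assms] by (auto simp: imag_quad_def)
  have cx: "cnj x = a - b * sqrt_neg n" using ab by (simp add: cnj_Rats)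
  have "x + cnj x = 2 * a" unfolding cx by (simp add: ab(3))
  then obtain A where A: "2 * a = of_int A" using quad_intsD(3)[OF assms] by (auto elim!: Ints_cases)
  let ?y = "sqrt_neg n * x"
  have "?y + cnj ?y = 2 * b * (sqrt_neg n * sqrt_neg n)"
    unfolding complex_cnj_mult cx cnj_sqrt_neg by (simp add: ab(3) algebra_simps)
  also have "\<dots> = - (2 * of_nat n * b)" by (simp only: sqrt_neg_sq) simp
  finally have "2 * of_nat n * b \<in> \<int>"
    using quad_intsD(3)[OF quad_ints_mult[OF quad_ints_sqrt_neg assms]] by simp
  then obtain C where C: "2 * of_nat n * b = of_int C" by (auto elim!: Ints_cases)
  have "of_nat (2 * n) * x = of_nat n * (2 * a) + (2 * of_nat n * b) * sqrt_neg n"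
    by (simp add: ab(3) algebra_simps)
  hence "of_nat (2 * n) * x = of_int (int n * A) + of_int C * sqrt_neg n" by (simp add: A C)
  thus ?thesis by (rule that)
qed

text \<open>Modulo \<open>p\<close> the denominator \<open>2n\<close> is invertible, so \<open>1\<close> and \<open>\<surd>-n\<close> generate.\<close>
lemma quad_ints_generated_mod_prime:
  assumes "Factorial_Ring.prime p" "\<not> p dvd 2 * n" "x \<in> quad_ints n"
  obtains A C :: int and y where "y \<in> quad_ints n"
    "x = of_int A + of_int C * sqrt_neg n + y * of_nat p"
proof -
  have "Rings.coprime p (2 * n)" using assms(1,2) by (rule prime_imp_coprime)
  hence "Rings.coprime (int p) (int (2 * n))" by (simp only: coprime_int_iff)
  then obtain v u where "v * int p + u * int (2 * n) = 1"
    using bezout_int[of "int p" "int (2 * n)"] by (auto simp: coprime_iff_gcd_eq_1)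
  hence "(of_int (v * int p + u * int (2 * n)) :: complex) = of_int 1" by (simp only:)
  hence uv: "1 = of_int v * of_nat p + of_int u * (of_nat (2 * n) :: complex)" by simp
  obtain A C :: int where AC: "of_nat (2 * n) * x = of_int (int n * A) + of_int C * sqrt_neg n"
    using quad_ints_trace_coords[OF assms(3)] by blast
  have "x = (of_int v * of_nat p + of_int u * of_nat (2 * n)) * x" unfolding uv[symmetric] by simp
  also have "\<dots> = of_int u * (of_nat (2 * n) * x) + (of_int v * x) * of_nat p"
    by (simp add: algebra_simps)
  also have "\<dots> = of_int (u * int n * A) + of_int (u * C) * sqrt_neg n + (of_int v * x) * of_nat p"
    by (simp only: AC) (simp add: algebra_simps)
  finally have x: "x = \<dots>" .
  show ?thesis by (rule that[OF quad_ints_mult[OF quad_ints_Ints assms(3), OF Ints_of_int] x])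
qed

text \<open>The residual degree is defined as the unique \<open>d\<close> such that the residue field has dimension
  \<open>d\<close>; the value \<open>1\<close> carries information only because the residue field is finite-dimensional,
  being spanned by the classes of \<open>1\<close> and \<open>\<surd>-n\<close>. Dimension one then means that the class of
  \<open>1\<close> alone spans it, so every class, in particular that of \<open>\<surd>-n\<close>, contains an integer.\<close>
lemma residual_degree_1_imp_int_residue:
  assumes p: "Factorial_Ring.prime p" "\<not> p dvd 2 * n" and "P \<in> primes_over (imag_quad n) p"
    and "residual_degree (imag_quad n) P = 1"
  obtains m :: int where "sqrt_neg n - of_int m \<in> P"
proof -
  let ?R = "quad_ring n" and ?k = "quad_ring n Quot P" and ?F = "int_residues n P"
  define h where "h = (\<lambda>x. P +>\<^bsub>?R\<^esub> x)"
  note P = prime_over_props[OF assms(3)]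
  note h_eq = coset_eq_iff[OF P(2), folded h_def]
  interpret R: cring ?R by (rule quad_ring_cring)
  interpret P: primeideal P ?R by (rule P)
  interpret k: domain ?k by (rule P.quotient_is_domain)
  interpret h: ring_hom_ring ?R ?k h unfolding h_def by (rule P.rcos_ring_hom_ring)
  note F = int_residues_subfield[OF P(1) p(1) P(4)]
  have hF: "h (of_int m) \<in> ?F" for m by (simp add: h_def int_residues_def)
  have h_closed: "h x \<in> carrier ?k" if "x \<in> quad_ints n" for x using h.hom_closed[of x] that by simp
  note ints = quad_ints_Ints[of _ n, OF Ints_of_int] quad_ints_sqrt_neg[of n]
  have carr: "set [\<one>\<^bsub>?k\<^esub>, h (sqrt_neg n)] \<subseteq> carrier ?k" using h_closed ints by auto
  have carr_h: "carrier ?k = h ` quad_ints n"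
    by (auto simp: FactRing_def A_RCOSETS_defs h_def a_r_coset_def)
  have "carrier ?k \<subseteq> ring.Span ?k ?F [\<one>\<^bsub>?k\<^esub>, h (sqrt_neg n)]"
  proof
    fix w assume "w \<in> carrier ?k"
    then obtain x where x: "x \<in> quad_ints n" "w = h x" using carr_h by blast
    obtain A C :: int and y where y: "y \<in> quad_ints n"
      "x = of_int A + of_int C * sqrt_neg n + y * of_nat p"
      using quad_ints_generated_mod_prime[OF p x(1)] by blast
    have "w = h (of_int A + of_int C * sqrt_neg n)"
      unfolding x(2) using x(1) y ints quad_ideal_closed(4)[OF P(2) P(4) y(1)]
      by (subst h_eq) (auto simp: quad_ints_add quad_ints_mult)
    also have "\<dots> = h (of_int A) \<oplus>\<^bsub>?k\<^esub> h (of_int C) \<otimes>\<^bsub>?k\<^esub> h (sqrt_neg n)"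
      using h.hom_add[of "of_int A" "of_int C * sqrt_neg n"] h.hom_mult[of "of_int C" "sqrt_neg n"]
      by (simp add: ints quad_ints_mult)
    also have "\<dots> = ring.combine ?k [h (of_int A), h (of_int C)] [\<one>\<^bsub>?k\<^esub>, h (sqrt_neg n)]"
      using h_closed ints by simp
    also have "\<dots> \<in> ring.Span ?k ?F [\<one>\<^bsub>?k\<^esub>, h (sqrt_neg n)]"
      unfolding k.Span_eq_combine_set_length_version[OF F carr] using hF by fastforce
    finally show "w \<in> ring.Span ?k ?F [\<one>\<^bsub>?k\<^esub>, h (sqrt_neg n)]" .
  qed
  hence "carrier ?k = ring.Span ?k ?F [\<one>\<^bsub>?k\<^esub>, h (sqrt_neg n)]"
    using k.Span_in_carrier[OF subfieldE(3)[OF F] carr] by blast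
  hence "ring.finite_dimension ?k ?F (carrier ?k)"
    using k.Span_finite_dimension[OF F carr] by simp
  hence "ring.dimension ?k (ring.dim ?k ?F (carrier ?k)) ?F (carrier ?k)"
    using k.finite_dimensionE[OF F] by (simp add: over_def)
  moreover have "ring.dim ?k ?F (carrier ?k) = 1"
    using assms(4) unfolding residual_degree_def Let_def int_residues_def .
  ultimately have dim: "ring.dimension ?k 1 ?F (carrier ?k)" by simp
  have "ring.independent ?k ?F [\<one>\<^bsub>?k\<^esub>]"
    by (rule k.li_Cons) auto
  hence "ring.Span ?k ?F [\<one>\<^bsub>?k\<^esub>] = carrier ?k"
    using k.independent_length_eq_dimension[OF F dim, of "[\<one>\<^bsub>?k\<^esub>]"] by simp
  hence "h (sqrt_neg n) \<in> ring.Span ?k ?F [\<one>\<^bsub>?k\<^esub>]" using h_closed ints by simp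
  then obtain f where f: "f \<in> ?F" "h (sqrt_neg n) = f"
    using subfieldE(3)[OF F] by (auto simp: k.line_extension_mem_iff subset_iff)
  then obtain m where "h (sqrt_neg n) = h (of_int m)" by (auto simp: int_residues_def h_def)
  hence "sqrt_neg n - of_int m \<in> P" using h_eq ints by simp
  thus ?thesis by (rule that)
qed

text \<open>If \<open>P\<close> is the only prime over \<open>p\<close>, it is its own conjugate, and conjugating
  \<open>\<surd>-n \<equiv> m\<close> modulo \<open>P\<close> gives \<open>-\<surd>-n \<equiv> m\<close>. The two together force \<open>p\<close> to divide \<open>2m\<close>, hence
  \<open>m\<close>, and then also \<open>n = -(\<surd>-n)\<^sup>2\<close>.\<close>
lemma s_inv_imag_quad_eq_0:
  assumes p: "Factorial_Ring.prime p" "\<not> p dvd 2 * n"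
  shows "s_inv p (imag_quad n) = 0"
proof (rule ccontr)
  assume "s_inv p (imag_quad n) \<noteq> 0"
  hence S: "splitting_type (imag_quad n) p = {#1#}" by (simp add: s_inv_def split: if_splits)
  then obtain P where P: "primes_over (imag_quad n) p = {P}" "residual_degree (imag_quad n) P = 1"
  proof -
    from S have "size (mset_set (primes_over (imag_quad n) p)) = 1"
      unfolding splitting_type_def by (metis size_image_mset size_single)
    hence "card (primes_over (imag_quad n) p) = 1" by simp
    then obtain P where "primes_over (imag_quad n) p = {P}" by (auto simp: card_1_singleton_iff)
    thus ?thesis using S that by (simp add: splitting_type_def)
  qed
  hence mem: "P \<in> primes_over (imag_quad n) p" by blast
  note pr = prime_over_props[OF mem]
  note I = quad_ideal_closed[OF pr(2)] and Z = of_int_mem_quad_ideal_iff[OF pr(2,3) p(1) pr(4)]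
  have cnjP: "cnj -` P = P" using primes_over_cnj[OF mem] unfolding P(1) by simp
  obtain m :: int where m: "sqrt_neg n - of_int m \<in> P"
    using residual_degree_1_imp_int_residue[OF p mem P(2)] .
  have "cnj (sqrt_neg n - of_int m) \<in> P" using m by (subst (asm) cnjP[symmetric]) simp
  hence "- sqrt_neg n - of_int m \<in> P" by simp
  from I(1)[OF m this] have "of_int (- 2 * m) \<in> P" by (simp add: algebra_simps)
  hence "int p dvd 2 * m" using Z[of "- 2 * m"] by simp
  moreover have "\<not> int p dvd int 2" using p(2) by (simp only: int_dvd_int_iff) (blast intro: dvd_mult2)
  hence "Rings.coprime (int p) 2" using p(1) by (intro prime_imp_coprime) auto
  ultimately have "int p dvd m" by (simp add: coprime_dvd_mult_right_iff)
  hence "of_int m \<in> P" using Z by blast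
  from I(1)[OF m this] have "sqrt_neg n \<in> P" by simp
  from I(4)[OF this quad_ints_sqrt_neg] have "of_int (- int n) \<in> P" by (simp add: sqrt_neg_sq)
  hence "int p dvd int n" using Z[of "- int n"] by simp
  hence "p dvd n" by simp
  thus False using p(2) by simp
qed

section \<open>A ramified prime\<close>

text \<open>Write \<open>2q x = q A + C \<surd>-q\<close>. Taking norms and dividing by \<open>q\<close> gives \<open>4 q N(x) = q A\<^sup>2 + C\<^sup>2\<close>, so \<open>q\<close>
  divides \<open>C\<close> and \<open>2x = A + B \<surd>-q\<close> with integers \<open>A\<close> and \<open>B\<close>. As \<open>q\<close> is odd, the factor \<open>2\<close> is
  removed modulo \<open>q = -(\<surd>-q)\<^sup>2\<close>: with \<open>q + 1 = 2t\<close> one has \<open>x = t (2x) - q x\<close>.\<close>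
lemma int_mod_sqrt_neg:
  assumes q: "Factorial_Ring.prime q" "odd q" and x: "x \<in> quad_ints q"
  obtains m :: int and y where "y \<in> quad_ints q" "x = of_int m + y * sqrt_neg q"
proof -
  let ?s = "sqrt_neg q"
  have q0: "of_nat q \<noteq> (0 :: complex)" using q by auto
  obtain A C where AC: "of_nat (2 * q) * x = of_int (int q * A) + of_int C * ?s"
    by (rule quad_ints_trace_coords[OF x])
  obtain N where N: "x * cnj x = of_int N" using quad_intsD(4)[OF x] by (auto elim: Ints_cases)
  have "of_int (4 * int q * N) * (of_nat q :: complex) = (of_nat (2 * q) * x) * cnj (of_nat (2 * q) * x)"
    using N by (simp add: algebra_simps)
  also have "\<dots> = of_int (int q * A) ^ 2 - of_int C ^ 2 * (?s * ?s)"
    unfolding AC by (simp add: algebra_simps power2_eq_square)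
  also have "\<dots> = of_int (int q * A ^ 2 + C ^ 2) * of_nat q"
    unfolding sqrt_neg_sq by (simp add: algebra_simps power2_eq_square)
  finally have "of_int (4 * int q * N) = (of_int (int q * A ^ 2 + C ^ 2) :: complex)"
    using q0 by (simp only: mult_cancel_right) simp
  hence "4 * int q * N = int q * A ^ 2 + C ^ 2" by (simp only: of_int_eq_iff)
  hence "C ^ 2 = int q * (4 * N - A ^ 2)" by (simp add: algebra_simps)
  hence "int q dvd C ^ 2" by (rule dvdI)
  hence "int q dvd C" using q(1) by (metis prime_dvd_power prime_int_nat_transfer prime_nat_int_transfer)
  then obtain B where B: "C = int q * B" by blast
  have "of_nat q * (2 * x) = of_nat q * (of_int A + of_int B * ?s)"
    using AC by (simp add: B algebra_simps)
  hence x2: "2 * x = of_int A + of_int B * ?s" using q0 by simp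
  obtain t where t: "q + 1 = 2 * t" using q(2) by (metis even_plus_one_iff evenE)
  have "x = of_nat (q + 1) * x - of_nat q * x" by (simp add: algebra_simps)
  also have "\<dots> = of_nat t * (2 * x) + (?s * ?s) * x" unfolding t sqrt_neg_sq by simp
  also have "\<dots> = of_int (int t * A) + (of_int (int t * B) + x * ?s) * ?s"
    unfolding x2 by (simp add: algebra_simps)
  finally have eq: "x = of_int (int t * A) + (of_int (int t * B) + x * ?s) * ?s" .
  have "of_int (int t * B) + x * ?s \<in> quad_ints q"
    by (intro quad_ints_add quad_ints_mult x quad_ints_sqrt_neg quad_ints_Ints Ints_of_int)
  thus ?thesis using eq by (rule that)
qed

text \<open>An inverse \<open>x\<close> of \<open>\<surd>-q\<close> would satisfy \<open>x\<^sup>2 = -1/q\<close>, which is rational but not an integer.\<close>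
lemma not_unit_sqrt_neg:
  assumes "q > 1" "x \<in> quad_ints q" shows "x * sqrt_neg q \<noteq> 1"
proof
  assume *: "x * sqrt_neg q = 1"
  have "(x * x) * of_nat q = - ((x * sqrt_neg q) * (x * sqrt_neg q))"
    using sqrt_neg_sq[of q] by (simp add: algebra_simps)
  hence eq: "(x * x) * of_nat q = -1" unfolding * by simp
  hence "x * x = - 1 / of_nat q" using assms(1) by (simp add: field_simps)
  hence "x * x \<in> \<rat>" by simp
  with quad_intsD(2)[OF quad_ints_mult[OF assms(2,2)]] have "x * x \<in> \<int>"
    by (rule rational_algebraic_int_is_int)
  then obtain k where "x * x = of_int k" by (rule Ints_cases)
  hence "of_int (k * int q) = (of_int (-1) :: complex)" using eq by simp
  hence "k * int q = -1" by (simp only: of_int_eq_iff)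
  hence "int q dvd 1" by (metis dvd_minus_iff dvd_triv_right)
  thus False using assms(1) by simp
qed

text \<open>Let \<open>P\<close> be the ideal generated by \<open>\<surd>-q\<close>. Because every class modulo \<open>P\<close> contains an integer
  and \<open>P\<close> meets \<open>\<int>\<close> in \<open>q\<int>\<close>, arithmetic modulo \<open>P\<close> is arithmetic modulo \<open>q\<close>. This single fact
  shows that \<open>P\<close> is prime, that it equals every prime \<open>Q\<close> containing it, and that its residual
  degree is \<open>1\<close>.\<close>
lemma s_inv_imag_quad_eq_1:
  assumes q: "Factorial_Ring.prime q" "odd q"
  shows "s_inv q (imag_quad q) = 1"
proof -
  let ?R = "quad_ring q" and ?s = "sqrt_neg q"
  interpret R: cring ?R by (rule quad_ring_cring)
  define P where "P = PIdl\<^bsub>?R\<^esub> ?s"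
  have P_iff: "x \<in> P \<longleftrightarrow> (\<exists>y\<in>quad_ints q. x = y * ?s)" for x
    by (auto simp: P_def cgenideal_def)
  have P: "ideal P ?R" unfolding P_def by (rule R.cgenideal_ideal) (simp add: quad_ints_sqrt_neg)
  note PI = quad_ideal_closed[OF P]
  have q_eq: "of_nat q = - ?s * ?s" using sqrt_neg_sq[of q] by simp
  have P1: "1 \<notin> P" using not_unit_sqrt_neg[of q] prime_gt_1_nat[OF q(1)] by (auto simp: P_iff)
  have qP: "of_nat q \<in> P"
    unfolding P_iff using q_eq quad_ints_uminus[OF quad_ints_sqrt_neg] by blast
  note Z = of_int_mem_quad_ideal_iff[OF P P1 q(1) qP]
  have residue: "\<exists>m :: int. x - of_int m \<in> P" if "x \<in> quad_ints q" for x
    using int_mod_sqrt_neg[OF q that] by (metis P_iff add_diff_cancel_left')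
  have prime: "primeideal P ?R"
  proof (rule primeidealI)
    show "carrier ?R \<noteq> P" using P1 quad_ints_Ints[of 1 q] by auto
    fix a b assume "a \<in> carrier ?R" "b \<in> carrier ?R" and "a \<otimes>\<^bsub>?R\<^esub> b \<in> P"
    hence ab: "a \<in> quad_ints q" "b \<in> quad_ints q" "a * b \<in> P" by simp_all
    obtain k l :: int where k: "a - of_int k \<in> P" and l: "b - of_int l \<in> P"
      using residue ab by blast
    have "of_int (k * l) = a * b - (a * (b - of_int l) + of_int l * (a - of_int k))"
      by (simp add: algebra_simps)
    also have "\<dots> \<in> P" by (intro PI ab k l quad_ints_Ints Ints_of_int)
    finally have "int q dvd k * l" using Z by blast
    hence "int q dvd k \<or> int q dvd l" using q(1) by (simp add: prime_dvd_mult_iff)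
    hence "of_int k \<in> P \<or> of_int l \<in> P" using Z by blast
    thus "a \<in> P \<or> b \<in> P" using PI(1)[OF k, of "of_int k"] PI(1)[OF l, of "of_int l"] by auto
  qed (rule P, rule quad_ring_cring)
  have PIdl_iff: "x \<in> PIdl\<^bsub>?R\<^esub> (of_nat q) \<longleftrightarrow> (\<exists>y\<in>quad_ints q. x = y * of_nat q)" for x
    by (auto simp: cgenideal_def)
  have square: "PIdl\<^bsub>?R\<^esub> (of_nat q) = P \<cdot>\<^bsub>?R\<^esub> P"
  proof (intro equalityI subsetI)
    fix x assume "x \<in> PIdl\<^bsub>?R\<^esub> (of_nat q)"
    then obtain y where y: "y \<in> quad_ints q" "x = y * of_nat q" unfolding PIdl_iff by blast
    have "x = (- y * ?s) \<otimes>\<^bsub>?R\<^esub> (1 * ?s)" unfolding y q_eq by simp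
    also have "\<dots> \<in> P \<cdot>\<^bsub>?R\<^esub> P"
    proof (rule ideal_prod.prod)
      show "- y * ?s \<in> P" unfolding P_iff by (rule bexI[OF refl quad_ints_uminus[OF y(1)]])
      show "1 * ?s \<in> P" unfolding P_iff by (rule bexI[OF refl quad_ints_Ints[OF Ints_1]])
    qed
    finally show "x \<in> P \<cdot>\<^bsub>?R\<^esub> P" .
  next
    fix x assume "x \<in> P \<cdot>\<^bsub>?R\<^esub> P"
    thus "x \<in> PIdl\<^bsub>?R\<^esub> (of_nat q)"
    proof (induction rule: ideal_prod.induct)
      case (prod i j)
      then obtain y z where yz: "y \<in> quad_ints q" "z \<in> quad_ints q" "i = y * ?s" "j = z * ?s"
        unfolding P_iff by blast
      have "i * j = (- (y * z)) * of_nat q" unfolding yz q_eq by simp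
      moreover have "- (y * z) \<in> quad_ints q" using yz by (intro quad_ints_uminus quad_ints_mult)
      ultimately show ?case unfolding quad_ring_simps PIdl_iff by (rule bexI)
    next
      case (sum x y)
      have "ideal (PIdl\<^bsub>?R\<^esub> (of_nat q)) ?R" by (rule R.cgenideal_ideal) (simp add: quad_ints_Ints)
      from quad_ideal_closed(1)[OF this sum.IH] show ?case by simp
    qed
  qed
  have "primes_over (imag_quad q) q = {P}"
  proof (intro equalityI subsetI)
    fix Q assume "Q \<in> primes_over (imag_quad q) q"
    note Q = prime_over_props[OF this]
    note QI = quad_ideal_closed[OF Q(2)]
    have "?s * ?s \<in> Q" using QI(2)[OF Q(4)] sqrt_neg_sq[of q] by simp
    hence "?s \<in> Q" using primeideal.I_prime[OF Q(1), of ?s ?s] quad_ints_sqrt_neg by auto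
    hence PQ: "P \<subseteq> Q" using QI(4) by (auto simp: P_iff)
    have "Q \<subseteq> P"
    proof
      fix x assume x: "x \<in> Q"
      obtain m :: int where m: "x - of_int m \<in> P" using residue QI(5)[OF x] by blast
      hence "of_int m \<in> Q" using QI(3)[OF x, of "x - of_int m"] PQ by auto
      hence "of_int m \<in> P" using Z of_int_mem_quad_ideal_iff[OF Q(2,3) q(1) Q(4)] by blast
      from PI(1)[OF m this] show "x \<in> P" by simp
    qed
    with PQ show "Q \<in> {P}" by blast
  next
    fix Q assume "Q \<in> {P}"
    thus "Q \<in> primes_over (imag_quad q) q"
      using prime P square by (auto simp: primes_over_def)
  qed
  moreover have "residual_degree (imag_quad q) P = 1"
  proof -
    let ?k = "?R Quot P"
    interpret P: primeideal P ?R by (rule prime)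
    interpret k: domain ?k by (rule P.quotient_is_domain)
    note F = int_residues_subfield[OF prime q(1) qP]
    have "carrier ?k \<subseteq> int_residues q P"
    proof
      fix w assume "w \<in> carrier ?k"
      then obtain x where x: "x \<in> quad_ints q" "w = P +>\<^bsub>?R\<^esub> x"
        by (auto simp: FactRing_def A_RCOSETS_defs a_r_coset_def)
      obtain m :: int where "x - of_int m \<in> P" using residue[OF x(1)] by blast
      hence "w = P +>\<^bsub>?R\<^esub> of_int m"
        unfolding x(2) using coset_eq_iff[OF P x(1)] quad_ints_Ints[of "of_int m" q] by simp
      thus "w \<in> int_residues q P" by (auto simp: int_residues_def)
    qed
    hence "carrier ?k = int_residues q P" using subfieldE(3)[OF F] by blast
    hence "ring.dimension ?k 1 (int_residues q P) (carrier ?k)"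
      using k.dimension_one[OF F] by simp
    from k.dimI[OF F this] have "ring.dim ?k (int_residues q P) (carrier ?k) = 1"
      by (simp add: over_def)
    thus ?thesis unfolding residual_degree_def Let_def int_residues_def .
  qed
  ultimately show ?thesis by (simp add: s_inv_def splitting_type_def)
qed

theorem theorem5p2:
  shows "\<exists>K\<^sub>1 K\<^sub>2. number_field K\<^sub>1 \<and> number_field K\<^sub>2 \<and>
           finite {p :: nat. Factorial_Ring.prime p \<and> s_inv p K\<^sub>1 \<noteq> s_inv p K\<^sub>2} \<and>
           (\<exists>p :: nat. Factorial_Ring.prime p \<and> s_inv p K\<^sub>1 \<noteq> s_inv p K\<^sub>2)"
proof (intro exI conjI)
  show "number_field (imag_quad 1)" "number_field (imag_quad 3)"
    by (rule number_field_imag_quad)+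
  \<comment> \<open>Both \<open>2 * 1\<close> and \<open>2 * 3\<close> divide \<open>6\<close>, so away from the divisors of \<open>6\<close> both values are \<open>0\<close>.\<close>
  have "p dvd 6" if "Factorial_Ring.prime p" "s_inv p (imag_quad 1) \<noteq> s_inv p (imag_quad 3)" for p
  proof (rule ccontr)
    assume "\<not> p dvd 6"
    moreover from this have "\<not> p dvd 2" using dvd_trans[of p 2 6] by auto
    ultimately have "s_inv p (imag_quad 1) = 0" "s_inv p (imag_quad 3) = 0"
      using that(1) by (simp_all add: s_inv_imag_quad_eq_0)
    thus False using that(2) by simp
  qed
  hence "{p. Factorial_Ring.prime p \<and> s_inv p (imag_quad 1) \<noteq> s_inv p (imag_quad 3)} \<subseteq> {p. p dvd 6}"
    by blast
  thus "finite {p. Factorial_Ring.prime p \<and> s_inv p (imag_quad 1) \<noteq> s_inv p (imag_quad 3)}"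
    by (rule finite_subset) simp
  show three: "Factorial_Ring.prime (3 :: nat)" by simp
  show "s_inv 3 (imag_quad 1) \<noteq> s_inv 3 (imag_quad 3)"
    using s_inv_imag_quad_eq_0[of 3 1] s_inv_imag_quad_eq_1[of 3] three by simp
qed

end
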